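(* Let $X=\bigcup_{n=1}^\infty G_n$ be the coarse disjoint union of a graph sequence $\{G_n\}$. If $\{G_n\}$ is an expander light sequence, then $X$ is not coarsely amenable.
   Context: A sequence of finite connected undirected graphs $\{G_n\}$ is a graph sequence if the number of vertices $|G_n|\to\infty$. Each $G_n$ is regarded as a metric space (its vertex set with the graph metric $d_n$). The coarse disjoint union of a sequence $\{(X_n,d_n)\}$ of bounded metric spaces is the disjoint union of all $X_n$ with the metric $d$ given by $d=d_n$ on $X_n\times X_n$ and $d(x,y)=\operatorname{diam}(X_i)+\operatorname{diam}(X_j)$ if $x\in X_i$, $y\in X_j$, $i\ne j$. For a subset $A$ of (the vertices of) a finite graph $G$, $\operatorname{halo}(A)$ is the set of vertices not in $A$ whose (open) $2$-ball in the graph metric intersects $A$. A graph sequence $\{G_i\}$ is an expander light sequence if there is $c>0$ such that for any uniformly bounded sequence of subsets $A_n\subset G_n$ (diameters in the graph metrics bounded by a common finite constant) one has $|\operatorname{halo}(A_n)|\ge c\cdot|A_n|$ for infinitely many $n$. In a metric space $X$, $B(x,r)=\{y:d(x,y)<r\}$. A cover of $X$ is an indexed family $\mathcal{U}=\{U_s\}_{s\in S}$ of subsets with union $X$ (counted with multiplicity); it is uniformly bounded if there is $r<\infty$ with $d(x,y)<r$ whenever $x,y$ lie in the same element. For $A\subset X$, $\operatorname{hor}(A,\mathcal{U})=\{s\in S: A\cap U_s\neq\emptyset\}$. $X$ is coarsely amenable if for each $s>r>0$ and each $\epsilon>0$ there is a uniformly bounded cover $\mathcal{U}$ of $X$ such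 that for each $x\in X$ the set $\operatorname{hor}(B(x,s),\mathcal{U})$ is finite and $\frac{|\operatorname{hor}(B(x,r),\mathcal{U})|}{|\operatorname{hor}(B(x,s),\mathcal{U})|}>1-\epsilon$. *)

theory Defs
  imports "HOL-Analysis.Analysis" "Graph_Theory.Graph_Theory"
begin

section \<open>Metric notions on a carrier set\<close>

text \<open>
  Metric spaces are given as in \<^locale>\<open>Metric_space\<close>, by a carrier \<open>M\<close> and a distance
  function \<open>d\<close>.  The ball is defined anew because \<open>Metric_space.mball\<close> can only be
  unfolded when \<open>Metric_space M d\<close> holds, and the coarse disjoint union has
  distinct points at distance \<open>0\<close> if two of the spaces are singletons
  (see \<open>coarse_union_metric\<close> below for the converse).
  The diameter is the analogue of \<^const>\<open>diameter\<close>; like the latter it is only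
  meaningful for bounded sets.
\<close>

definition open_ball :: "'a set \<Rightarrow> ('a \<Rightarrow> 'a \<Rightarrow> real) \<Rightarrow> 'a \<Rightarrow> real \<Rightarrow> 'a set" where
  "open_ball M d x r = {y \<in> M. d x y < r}"

lemma (in Metric_space) open_ball_eq_mball: "x \<in> M \<Longrightarrow> open_ball M d x r = mball x r"
  by (auto simp: open_ball_def)

definition mdiameter :: "('a \<Rightarrow> 'a \<Rightarrow> real) \<Rightarrow> 'a set \<Rightarrow> real" where
  "mdiameter d A = (if A = {} then 0 else (SUP (x, y)\<in>A \<times> A. d x y))"

text \<open>The carrier of the coarse disjoint union of spaces \<open>(M n, d n)\<close> is
  \<open>SIGMA n:UNIV. M n\<close>.\<close>

definition coarse_union_dist ::
  "(nat \<Rightarrow> 'a set) \<Rightarrow> (nat \<Rightarrow> 'a \<Rightarrow> 'a \<Rightarrow> real) \<Rightarrow> nat \<times> 'a \<Rightarrow> nat \<times> 'a \<Rightarrow> real" where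
  "coarse_union_dist M d p q =
     (if fst p = fst q then d (fst p) (snd p) (snd q)
      else mdiameter (d (fst p)) (M (fst p)) + mdiameter (d (fst q)) (M (fst q)))"

lemma coarse_union_metric:
  assumes M: "\<And>n. Metric_space (M n) (d n)"
    and bdd: "\<And>n. Metric_space.mbounded (M n) (d n) (M n)"
    and singleton: "\<And>m n x y. M m = {x} \<Longrightarrow> M n = {y} \<Longrightarrow> m = n"
  shows "Metric_space (SIGMA n:UNIV. M n) (coarse_union_dist M d)"
proof -
  have diam: "d n x y \<le> mdiameter (d n) (M n)" if "x \<in> M n" "y \<in> M n" for n x y
  proof -
    interpret Metric_space "M n" "d n" by (rule M)
    obtain B where "\<forall>x\<in>M n. \<forall>y\<in>M n. d n x y \<le> B"
      using bdd[of n] unfolding mbounded_alt by blast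
    then have "bdd_above ((\<lambda>(x, y). d n x y) ` (M n \<times> M n))"
      by (intro bdd_aboveI[of _ B]) auto
    then have "(case (x, y) of (x, y) \<Rightarrow> d n x y) \<le> (SUP (x, y)\<in>M n \<times> M n. d n x y)"
      using that by (intro cSUP_upper) auto
    then show ?thesis using that by (auto simp: mdiameter_def)
  qed
  have nonneg: "0 \<le> d n x y" and commute: "d n x y = d n y x" for n x y
    by (rule Metric_space.nonneg[OF M], rule Metric_space.commute[OF M])
  have zero: "d n x y = 0 \<longleftrightarrow> x = y" if "x \<in> M n" "y \<in> M n" for n x y
    by (rule Metric_space.zero[OF M that])
  have tri: "d n x z \<le> d n x y + d n y z" if "x \<in> M n" "y \<in> M n" "z \<in> M n" for n x y z
    by (rule Metric_space.triangle[OF M that])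
  have diam_nonneg: "0 \<le> mdiameter (d n) (M n)" for n
  proof (cases "M n = {}")
    case True
    then show ?thesis by (simp add: mdiameter_def)
  next
    case False
    then obtain x where "x \<in> M n" by blast
    then show ?thesis using diam nonneg order_trans by blast
  qed
  have diam_zero: "M n = {x}" if "x \<in> M n" "mdiameter (d n) (M n) = 0" for n x
  proof -
    have "y = x" if "y \<in> M n" for y
      using diam[OF \<open>x \<in> M n\<close> that] nonneg[of n x y] zero[OF \<open>x \<in> M n\<close> that]
        \<open>mdiameter (d n) (M n) = 0\<close> by simp
    then show ?thesis using \<open>x \<in> M n\<close> by blast
  qed
  show ?thesis
  proof
    show "0 \<le> coarse_union_dist M d p q" for p q
      using nonneg diam_nonneg by (simp add: coarse_union_dist_def)
    show "coarse_union_dist M d p q = coarse_union_dist M d q p" for p q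
      using commute by (simp add: coarse_union_dist_def)
    show "coarse_union_dist M d p q = 0 \<longleftrightarrow> p = q"
      if "p \<in> (SIGMA n:UNIV. M n)" "q \<in> (SIGMA n:UNIV. M n)" for p q
    proof (cases "fst p = fst q")
      case True
      then show ?thesis using that zero by (auto simp: coarse_union_dist_def)
    next
      case False
      have "mdiameter (d (fst p)) (M (fst p)) + mdiameter (d (fst q)) (M (fst q)) \<noteq> 0"
      proof
        assume "mdiameter (d (fst p)) (M (fst p)) + mdiameter (d (fst q)) (M (fst q)) = 0"
        then have "mdiameter (d (fst p)) (M (fst p)) = 0" "mdiameter (d (fst q)) (M (fst q)) = 0"
          using diam_nonneg[of "fst p"] diam_nonneg[of "fst q"] by linarith+
        then have "M (fst p) = {snd p}" "M (fst q) = {snd q}"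
          using that by (auto intro!: diam_zero)
        then show False using singleton False by blast
      qed
      then show ?thesis using False by (auto simp: coarse_union_dist_def)
    qed
    show "coarse_union_dist M d p r \<le> coarse_union_dist M d p q + coarse_union_dist M d q r"
      if "p \<in> (SIGMA n:UNIV. M n)" "q \<in> (SIGMA n:UNIV. M n)" "r \<in> (SIGMA n:UNIV. M n)"
      for p q r
    proof -
      obtain i x j y k z where eqs: "p = (i, x)" "q = (j, y)" "r = (k, z)"
        by (metis surj_pair)
      have mem: "x \<in> M i" "y \<in> M j" "z \<in> M k" using that eqs by auto
      consider "i = j" "j = k" | "i = k" "i \<noteq> j" | "i = j" "j \<noteq> k" | "i \<noteq> j" "j = k"
        | "i \<noteq> j" "j \<noteq> k" "i \<noteq> k" by blast
      then show ?thesis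
      proof cases
        case 1
        then show ?thesis using tri mem by (simp add: eqs coarse_union_dist_def)
      next
        case 2
        then have "d i x z \<le> mdiameter (d i) (M i)" using diam mem by simp
        then show ?thesis
          using 2 diam_nonneg[of i] diam_nonneg[of j] by (simp add: eqs coarse_union_dist_def)
      next
        case 3
        then show ?thesis using nonneg[of j x y] by (simp add: eqs coarse_union_dist_def)
      next
        case 4
        then show ?thesis using nonneg[of k y z] by (simp add: eqs coarse_union_dist_def)
      next
        case 5
        then show ?thesis using diam_nonneg[of j] by (simp add: eqs coarse_union_dist_def)
      qed
    qed
  qed
qed

section \<open>Graph sequences and expander light sequences\<close>

text \<open>
  A finite undirected graph is a finite symmetric digraph (\<^locale>\<open>pseudo_graph\<close>).  Loops and
  parallel edges are permitted; they do not influence the graph metric.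
  The value \<open>wf_digraph.\<mu> G (\<lambda>_. 1) u v\<close> is the least length of a walk from \<open>u\<close> to \<open>v\<close>;
  it is finite when \<open>G\<close> is connected, so that no information is lost by
  \<^const>\<open>real_of_ereal\<close>.
\<close>

definition graph_dist :: "('a, 'b) pre_digraph \<Rightarrow> 'a \<Rightarrow> 'a \<Rightarrow> real" where
  "graph_dist G u v = real_of_ereal (wf_digraph.\<mu> G (\<lambda>_. 1) u v)"

lemma graph_dist_metric:
  assumes "pseudo_graph G" "connected G"
  shows "Metric_space (verts G) (graph_dist G)"
proof -
  interpret pseudo_graph G by fact
  let ?one = "\<lambda>_ :: 'b. 1 :: real"
  have cost: "awalk_cost ?one p = length p" for p
    by (induction p) auto
  have sc: "strongly_connected G"
    using assms(2) sym_arcs by (rule symmetric_connected_imp_strongly_connected[rotated])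
  have attained: "\<exists>p. awalk u p v \<and> graph_dist G u v = length p \<and>
      (\<forall>q. awalk u q v \<longrightarrow> length p \<le> length q)" if "u \<in> verts G" "v \<in> verts G" for u v
  proof -
    have "\<exists>p. awalk u p v"
      using sc that by (auto simp: strongly_connected_def reachable_awalk)
    then obtain p where p: "awalk u p v" "\<And>q. awalk u q v \<Longrightarrow> length p \<le> length q"
      using ex_has_least_nat[of "\<lambda>p. awalk u p v" _ length] by blast
    have "\<mu> ?one u v = ereal (length p)"
      unfolding \<mu>_def cost
      by (intro antisym INF_lower INF_greatest) (use p in auto)
    then show ?thesis using p by (auto simp: graph_dist_def)
  qed
  have sym: "\<exists>q. awalk v q u \<and> length q = length p" if "awalk u p v" for u p v
    using that
  proof (induction p arbitrary: u)
    case Nil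
    then show ?case by (auto simp: awalk_Nil_iff)
  next
    case (Cons e p)
    then have e: "e \<in> arcs G" "tail G e = u" and "awalk (head G e) p v"
      by (auto simp: awalk_Cons_iff)
    then obtain q where q: "awalk v q (head G e)" "length q = length p"
      using Cons.IH by blast
    obtain f where f: "f \<in> arcs G" "tail G f = head G e" "head G f = u"
      using sym_arcs e unfolding symmetric_conv by metis
    then have "awalk (head G e) [f] u"
      by (auto simp: awalk_Cons_iff awalk_Nil_iff)
    then have "awalk v (q @ [f]) u" using q by (blast intro: awalk_appendI)
    moreover have "length (q @ [f]) = length (e # p)" using q by simp
    ultimately show ?case by blast
  qed
  have le: "graph_dist G u v \<le> length p" if "awalk u p v" for u v p
  proof -
    have "u \<in> verts G" "v \<in> verts G" using that by auto
    from attained[OF this] that show ?thesis by auto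
  qed
  have commute_le: "graph_dist G u v \<le> graph_dist G v u"
    if uv: "u \<in> verts G" "v \<in> verts G" for u v
    using attained[OF uv(2,1)] sym le by metis
  show ?thesis
  proof
    show "0 \<le> graph_dist G u v" for u v
    proof -
      have "0 \<le> \<mu> ?one u v"
        unfolding \<mu>_def cost by (intro INF_greatest) auto
      then show ?thesis unfolding graph_dist_def by (rule real_of_ereal_pos)
    qed
    show "graph_dist G u v = graph_dist G v u" for u v
    proof (cases "u \<in> verts G \<and> v \<in> verts G")
      case True
      then show ?thesis using commute_le by (meson antisym)
    next
      case False
      then have "\<not> u \<rightarrow>\<^sup>*\<^bsub>G\<^esub> v" "\<not> v \<rightarrow>\<^sup>*\<^bsub>G\<^esub> u"
        by (auto elim: reachable_in_vertsE)
      then show ?thesis by (simp add: graph_dist_def shortest_path_inf)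
    qed
    show "graph_dist G u v = 0 \<longleftrightarrow> u = v" if uv: "u \<in> verts G" "v \<in> verts G" for u v
    proof
      assume "graph_dist G u v = 0"
      then show "u = v" using attained[OF uv] by (auto simp: awalk_Nil_iff)
    next
      assume "u = v"
      then have "awalk u [] v" using uv by (simp add: awalk_Nil_iff)
      then have "graph_dist G u v \<le> 0" using le[of u "[]" v] by simp
      moreover obtain p where "graph_dist G u v = length (p :: 'b list)"
        using attained[OF uv] by blast
      ultimately show "graph_dist G u v = 0" by simp
    qed
    show "graph_dist G u w \<le> graph_dist G u v + graph_dist G v w"
      if uvw: "u \<in> verts G" "v \<in> verts G" "w \<in> verts G" for u v w
    proof -
      obtain p q where "awalk u p v" "graph_dist G u v = length p"
        "awalk v q w" "graph_dist G v w = length q"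
        using attained uvw by metis
      then show ?thesis using le[of u "p @ q" w] by (auto intro: awalk_appendI)
    qed
  qed
qed

definition graph_sequence :: "(nat \<Rightarrow> ('a, 'b) pre_digraph) \<Rightarrow> bool" where
  "graph_sequence G \<longleftrightarrow>
     (\<forall>n. pseudo_graph (G n) \<and> connected (G n)) \<and>
     filterlim (\<lambda>n. card (verts (G n))) at_top sequentially"

definition halo :: "('a, 'b) pre_digraph \<Rightarrow> 'a set \<Rightarrow> 'a set" where
  "halo G A = {x \<in> verts G. x \<notin> A \<and> open_ball (verts G) (graph_dist G) x 2 \<inter> A \<noteq> {}}"

definition expander_light :: "(nat \<Rightarrow> ('a, 'b) pre_digraph) \<Rightarrow> bool" where
  "expander_light G \<longleftrightarrow>
     (\<exists>c>0. \<forall>A. (\<forall>n. A n \<subseteq> verts (G n)) \<longrightarrow>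
        (\<exists>R. \<forall>n. mdiameter (graph_dist (G n)) (A n) \<le> R) \<longrightarrow>
        (\<exists>\<^sub>\<infinity>n. real (card (halo (G n) (A n))) \<ge> c * real (card (A n))))"

section \<open>Coarse amenability\<close>

text \<open>A cover is an indexed family \<open>U\<close> with index set \<open>S\<close>, so members are counted with
  multiplicity.\<close>

definition is_cover :: "'x set \<Rightarrow> 'i set \<Rightarrow> ('i \<Rightarrow> 'x set) \<Rightarrow> bool" where
  "is_cover X S U \<longleftrightarrow> (\<Union>i\<in>S. U i) = X"

definition uniformly_bounded ::
  "('x \<Rightarrow> 'x \<Rightarrow> real) \<Rightarrow> 'i set \<Rightarrow> ('i \<Rightarrow> 'x set) \<Rightarrow> bool" where
  "uniformly_bounded d S U \<longleftrightarrow> (\<exists>R. \<forall>i\<in>S. \<forall>x\<in>U i. \<forall>y\<in>U i. d x y < R)"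

definition hor :: "'x set \<Rightarrow> 'i set \<Rightarrow> ('i \<Rightarrow> 'x set) \<Rightarrow> 'i set" where
  "hor A S U = {i \<in> S. A \<inter> U i \<noteq> {}}"

definition amenability_cover ::
  "'x set \<Rightarrow> ('x \<Rightarrow> 'x \<Rightarrow> real) \<Rightarrow> real \<Rightarrow> real \<Rightarrow> real \<Rightarrow> 'i set \<Rightarrow> ('i \<Rightarrow> 'x set) \<Rightarrow> bool" where
  "amenability_cover X d r s \<epsilon> S U \<longleftrightarrow>
     is_cover X S U \<and> uniformly_bounded d S U \<and>
     (\<forall>x\<in>X. finite (hor (open_ball X d x s) S U) \<and>
        real (card (hor (open_ball X d x r) S U)) /
        real (card (hor (open_ball X d x s) S U)) > 1 - \<epsilon>)"

text \<open>
  HOL does not quantify over types inside a formula, so the index sets of the covers have to be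
  taken in one fixed type.  The type \<open>'x \<times> nat\<close> is large enough for every cover in question:
  see \<open>amenability_cover_index_type\<close> below.
\<close>

definition coarsely_amenable :: "'x set \<Rightarrow> ('x \<Rightarrow> 'x \<Rightarrow> real) \<Rightarrow> bool" where
  "coarsely_amenable X d \<longleftrightarrow>
     (\<forall>r s \<epsilon>. 0 < r \<and> r < s \<and> 0 < \<epsilon> \<longrightarrow>
        (\<exists>(S :: ('x \<times> nat) set) U. amenability_cover X d r s \<epsilon> S U))"

lemma amenability_cover_index_type:
  fixes X :: "'x set" and S :: "'i set"
  assumes cov: "amenability_cover X d r s \<epsilon> S U"
    and refl: "\<And>x. x \<in> X \<Longrightarrow> d x x = 0" and "0 < s"
  shows "\<exists>(S' :: ('x \<times> nat) set) U'. amenability_cover X d r s \<epsilon> S' U'"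
proof -
  let ?B = "open_ball X d"
  define S0 where "S0 = {i \<in> S. U i \<noteq> {}}"
  define p where "p i = (SOME x. x \<in> U i)" for i
  have p: "p i \<in> U i" "p i \<in> X" if "i \<in> S0" for i
  proof -
    show "p i \<in> U i"
      using that some_in_eq unfolding S0_def p_def by blast
    then show "p i \<in> X"
      using that cov by (auto simp: S0_def amenability_cover_def is_cover_def)
  qed
  have fin: "finite {j \<in> S0. p j = x}" for x
  proof (cases "x \<in> X")
    case True
    then have "x \<in> open_ball X d x s"
      using refl \<open>0 < s\<close> by (simp add: open_ball_def)
    then have "{j \<in> S0. p j = x} \<subseteq> hor (?B x s) S U"
      using p by (auto simp: hor_def S0_def)
    then show ?thesis
      by (rule finite_subset) (use cov True in \<open>simp add: amenability_cover_def\<close>)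
  next
    case False
    then have "{j \<in> S0. p j = x} = {}" using p by auto
    then show ?thesis by (metis finite.emptyI)
  qed
  define g where "g i = (p i, to_nat_on {j \<in> S0. p j = p i} i)" for i
  have inj: "inj_on g S0"
  proof (rule inj_onI)
    fix i j assume *: "i \<in> S0" "j \<in> S0" "g i = g j"
    then have eq: "p i = p j" by (simp add: g_def)
    have "inj_on (to_nat_on {k \<in> S0. p k = p i}) {k \<in> S0. p k = p i}"
      using fin by (intro inj_on_to_nat_on countable_finite)
    then show "i = j"
      using * eq by (auto simp: g_def inj_on_def)
  qed
  define U' where "U' = U \<circ> inv_into S0 g"
  have U': "U' (g i) = U i" if "i \<in> S0" for i
    using that inj by (simp add: U'_def)
  have hor: "hor A (g ` S0) U' = g ` hor A S U" for A
  proof -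
    have "hor A (g ` S0) U' = g ` {i \<in> S0. A \<inter> U' (g i) \<noteq> {}}"
      unfolding hor_def by blast
    also have "{i \<in> S0. A \<inter> U' (g i) \<noteq> {}} = {i \<in> S0. A \<inter> U i \<noteq> {}}"
      using U' by auto
    also have "\<dots> = hor A S U"
      by (auto simp: hor_def S0_def)
    finally show ?thesis .
  qed
  have sub: "hor A S U \<subseteq> S0" for A
    by (auto simp: hor_def S0_def)
  have card: "card (hor A (g ` S0) U') = card (hor A S U)" for A
    unfolding hor using inj sub by (metis card_image inj_on_subset)
  have "is_cover X (g ` S0) U'"
  proof -
    have "(\<Union>k\<in>g ` S0. U' k) = (\<Union>i\<in>S0. U i)" using U' by simp
    also have "\<dots> = X" using cov by (auto simp: amenability_cover_def is_cover_def S0_def)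
    finally show ?thesis by (simp add: is_cover_def)
  qed
  moreover have "uniformly_bounded d (g ` S0) U'"
  proof -
    obtain R where "\<forall>i\<in>S. \<forall>x\<in>U i. \<forall>y\<in>U i. d x y < R"
      using cov by (auto simp: amenability_cover_def uniformly_bounded_def)
    then have "\<forall>k\<in>g ` S0. \<forall>x\<in>U' k. \<forall>y\<in>U' k. d x y < R"
      using U' by (auto simp: S0_def)
    then show ?thesis unfolding uniformly_bounded_def by blast
  qed
  moreover have "finite (hor A (g ` S0) U')" if "finite (hor A S U)" for A
    using that by (simp add: hor)
  ultimately have "amenability_cover X d r s \<epsilon> (g ` S0) U'"
    using cov by (simp add: amenability_cover_def card)
  then show ?thesis by blast
qed

end

theory Submission
  imports Defs
begin

text \<open>
  With \<open>r = 1\<close>, \<open>s = 2\<close> and \<open>\<epsilon> = c / (1 + c)\<close>, a cover witnessing coarse amenability is traced on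
  a graph of diameter at least \<open>2\<close>. There \<open>r\<close>-balls are points and an \<open>s\<close>-ball meets \<open>A\<close> iff its
  centre lies in \<open>A \<union> halo A\<close>. Counting the pairs (vertex, cover element) in two ways, the amenability
  inequality summed over all vertices yields a cover element whose trace \<open>A\<close> is nonempty with
  \<open>|A \<union> halo A| < (1 + c) |A|\<close>. On a graph of diameter less than \<open>2\<close> the full vertex set,
  whose halo is empty, does the job. These sets are uniformly bounded and refute \<open>c\<close>.
\<close>

text \<open>A walk between distinct vertices has at least one arc. This is what makes unit balls in
  a component singletons.\<close>

lemma graph_dist_ge_1:
  assumes "pseudo_graph G" "connected G" "u \<in> verts G" "v \<in> verts G" "u \<noteq> v"
  shows "1 \<le> graph_dist G u v"
proof -
  interpret pseudo_graph G by fact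
  have cost: "awalk_cost (\<lambda>_. 1 :: real) p = length p" for p :: "'b list"
    by (induction p) auto
  have "strongly_connected G"
    using assms(2) sym_arcs by (rule symmetric_connected_imp_strongly_connected[rotated])
  then obtain p where p: "awalk u p v"
    using assms(3,4) by (auto simp: strongly_connected_def reachable_awalk)
  \<comment> \<open>An actual walk keeps the infimum finite; at infinity
    \<open>real_of_ereal\<close> would return 0.\<close>
  have le: "\<mu> (\<lambda>_. 1) u v \<le> ereal (length p)"
    unfolding \<mu>_def cost by (rule INF_lower) (use p in auto)
  have "1 \<le> length q" if "awalk u q v" for q
    using that \<open>u \<noteq> v\<close> by (cases q) (auto simp: awalk_Nil_iff)
  then have ge: "1 \<le> \<mu> (\<lambda>_. 1) u v"
    unfolding \<mu>_def cost by (intro INF_greatest) auto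
  from le ge show ?thesis
    by (cases "\<mu> (\<lambda>_. 1) u v") (auto simp: graph_dist_def)
qed

lemma mdiameter_upper:
  assumes "finite A" "x \<in> A" "y \<in> A"
  shows "d x y \<le> mdiameter d A"
proof -
  have "(case (x, y) of (x, y) \<Rightarrow> d x y) \<le> (SUP (x, y)\<in>A \<times> A. d x y)"
    using assms by (intro cSUP_upper bdd_above_finite) auto
  then show ?thesis using assms by (auto simp: mdiameter_def)
qed

lemma mdiameter_least:
  assumes "A \<noteq> {}" "\<And>x y. x \<in> A \<Longrightarrow> y \<in> A \<Longrightarrow> d x y \<le> R"
  shows "mdiameter d A \<le> R"
  using assms by (auto simp: mdiameter_def intro!: cSUP_least)

text \<open>Double counting: summing \<open>less\<close> over the nonempty set \<open>V\<close>
  counts the incidences of the \<open>N i\<close> and of the \<open>A i\<close>. If every index had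
  the reverse inequality, summing over \<open>T\<close> would contradict this.\<close>

lemma exists_small_expansion:
  fixes V :: "'v set" and A N :: "'i \<Rightarrow> 'v set" and C :: real
  assumes "finite V" "V \<noteq> {}" "finite T"
    and sub: "\<And>i. i \<in> T \<Longrightarrow> A i \<subseteq> V" "\<And>i. i \<in> T \<Longrightarrow> N i \<subseteq> V"
    and less: "\<And>x. x \<in> V \<Longrightarrow> real (card {i \<in> T. x \<in> N i}) < C * real (card {i \<in> T. x \<in> A i})"
  shows "\<exists>i\<in>T. real (card (N i)) < C * real (card (A i))"
proof (rule ccontr)
  assume "\<not> ?thesis"
  then have ge: "C * real (card (A i)) \<le> real (card (N i))" if "i \<in> T" for i
    using that by force
  have count: "(\<Sum>x\<in>V. card {i \<in> T. x \<in> B i}) = (\<Sum>i\<in>T. card (B i))"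
    if "\<And>i. i \<in> T \<Longrightarrow> B i \<subseteq> V" for B :: "'i \<Rightarrow> 'v set"
  proof -
    have "B i = {x \<in> V. x \<in> B i}" if "i \<in> T" for i
      using that \<open>\<And>i. i \<in> T \<Longrightarrow> B i \<subseteq> V\<close> by blast
    then show ?thesis
      using \<open>finite V\<close> \<open>finite T\<close> by (intro sum_multicount_gen) auto
  qed
  have "real (\<Sum>x\<in>V. card {i \<in> T. x \<in> N i}) < C * real (\<Sum>x\<in>V. card {i \<in> T. x \<in> A i})"
    using assms(1,2) less by (simp add: sum_distrib_left sum_strict_mono)
  also have "\<dots> = (\<Sum>i\<in>T. C * real (card (A i)))"
    by (simp add: count[OF sub(1)] sum_distrib_left)
  also have "\<dots> \<le> real (\<Sum>i\<in>T. card (N i))"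
    using ge by (simp add: sum_mono)
  finally show False
    by (simp add: count[OF sub(2)])
qed

text \<open>The diameter bound puts every other component at distance at least 2, so the balls of
  radius 1 and 2 in the union never leave component \<open>n\<close>. There the two horizons of
  \<open>x\<close> become the indices whose trace, or trace plus halo, contains
  \<open>x\<close>.\<close>

lemma amenability_cover_small_halo:
  fixes G :: "nat \<Rightarrow> ('a, 'b) pre_digraph"
  defines "M \<equiv> \<lambda>n. verts (G n)" and "d \<equiv> \<lambda>n. graph_dist (G n)"
  assumes graph: "\<And>n. pseudo_graph (G n)" "\<And>n. connected (G n)"
    and cov: "amenability_cover (SIGMA n:UNIV. M n) (coarse_union_dist M d) 1 2 (c / (1 + c)) S U"
    and "c > 0" and diam: "mdiameter (d n) (M n) \<ge> 2"
  shows "\<exists>i\<in>S. real (card (halo (G n) (Pair n -` U i))) < c * real (card (Pair n -` U i))"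
proof -
  let ?X = "SIGMA n:UNIV. M n" and ?d = "coarse_union_dist M d"
  let ?A = "\<lambda>i. Pair n -` U i"
  let ?N = "\<lambda>i. ?A i \<union> halo (G n) (?A i)"
  have metric: "Metric_space (M k) (d k)" for k
    using graph_dist_metric[OF graph] by (simp add: M_def d_def)
  have fin: "finite (M k)" and ne: "M k \<noteq> {}" for k
  proof -
    interpret pseudo_graph "G k" by (rule graph)
    show "finite (M k)" by (simp add: M_def)
    show "M k \<noteq> {}" using graph(2)[of k] by (auto simp: M_def connected_def strongly_connected_def)
  qed
  have diam_nonneg: "0 \<le> mdiameter (d k) (M k)" for k
  proof -
    obtain x where "x \<in> M k" using ne by blast
    then show ?thesis
      using mdiameter_upper[OF fin, of x k x "d k"] Metric_space.nonneg[OF metric] order_trans by blast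
  qed
  have self: "d n x x = 0" if "x \<in> M n" for x
    using Metric_space.zero[OF metric that that] by simp
  have dist: "?d (n, x) (n, y) = d n x y" for x y
    by (simp add: coarse_union_dist_def)
  have far: "2 \<le> ?d (n, x) (m, y)" if "m \<noteq> n" for m x y
    using that diam diam_nonneg[of m] by (simp add: coarse_union_dist_def)
  have ball: "open_ball ?X ?d (n, x) r = Pair n ` open_ball (M n) (d n) x r" if "r \<le> 2" for x r
  proof -
    have "m = n" if "?d (n, x) (m, y) < r" for m y
      using far[of m x y] that \<open>r \<le> 2\<close> by fastforce
    then show ?thesis by (fastforce simp: open_ball_def dist)
  qed
  have "open_ball (M n) (d n) x 1 = {x}" if "x \<in> M n" for x
  proof -
    have "y = x" if "y \<in> M n" "d n x y < 1" for y
      using graph_dist_ge_1[OF graph, of x n y] that \<open>x \<in> M n\<close> by (force simp: M_def d_def)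
    then show ?thesis using that self by (auto simp: open_ball_def)
  qed
  then have ball1: "open_ball ?X ?d (n, x) 1 = {(n, x)}" if "x \<in> M n" for x
    using that by (simp add: ball)
  have "(\<Union>i\<in>S. U i) = ?X"
    using cov by (simp add: amenability_cover_def is_cover_def)
  then have A: "?A i \<subseteq> M n" if "i \<in> S" for i
    using that by blast
  \<comment> \<open>The halo is cut out by 2-balls, which is why the outer radius is 2; a point of
    the trace itself is covered because it lies in its own ball.\<close>
  have N: "x \<in> ?N i \<longleftrightarrow> open_ball (M n) (d n) x 2 \<inter> ?A i \<noteq> {}" if "x \<in> M n" "i \<in> S" for x i
    using that self by (auto simp: halo_def open_ball_def M_def d_def)
  have hor1: "hor (open_ball ?X ?d (n, x) 1) S U = {i \<in> S. x \<in> ?A i}" if "x \<in> M n" for x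
    by (auto simp: hor_def ball1[OF that])
  have hor2: "hor (open_ball ?X ?d (n, x) 2) S U = {i \<in> S. x \<in> ?N i}" if "x \<in> M n" for x
    using N[OF that] by (auto simp: hor_def ball)
  \<comment> \<open>\<open>S\<close> may be infinite. Only indices seen from component
    \<open>n\<close> matter, and these are finitely many since \<open>M n\<close> and each horizon
    are finite.\<close>
  define T where "T = (\<Union>x\<in>M n. {i \<in> S. x \<in> ?N i})"
  have hor: "finite {i \<in> S. x \<in> ?N i}"
    "real (card {i \<in> S. x \<in> ?A i}) / real (card {i \<in> S. x \<in> ?N i}) > 1 - c / (1 + c)"
    if "x \<in> M n" for x
  proof -
    have "(n, x) \<in> ?X" using that by simp
    with cov have "finite (hor (open_ball ?X ?d (n, x) 2) S U) \<and>
        real (card (hor (open_ball ?X ?d (n, x) 1) S U)) /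
        real (card (hor (open_ball ?X ?d (n, x) 2) S U)) > 1 - c / (1 + c)"
      unfolding amenability_cover_def by blast
    then show "finite {i \<in> S. x \<in> ?N i}"
      "real (card {i \<in> S. x \<in> ?A i}) / real (card {i \<in> S. x \<in> ?N i}) > 1 - c / (1 + c)"
      unfolding hor1[OF that] hor2[OF that] by (rule conjunct1, rule conjunct2)
  qed
  have "finite T"
    unfolding T_def using fin hor(1) by blast
  have "\<exists>i\<in>T. real (card (?N i)) < (1 + c) * real (card (?A i))"
  proof (rule exists_small_expansion[OF fin ne \<open>finite T\<close>])
    fix i assume "i \<in> T"
    then show "?A i \<subseteq> M n" "?N i \<subseteq> M n"
      using A by (auto simp: T_def halo_def M_def)
  next
    fix x assume x: "x \<in> M n"
    let ?a = "real (card {i \<in> S. x \<in> ?A i})" and ?b = "real (card {i \<in> S. x \<in> ?N i})"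
    \<comment> \<open>The choice of \<epsilon> turns the amenability ratio into expansion by less
      than the factor \<open>1 + c\<close>.\<close>
    have "1 - c / (1 + c) = 1 / (1 + c)"
      using \<open>c > 0\<close> by (simp add: field_simps)
    then have quot: "1 / (1 + c) < ?a / ?b"
      using hor(2)[OF x] by simp
    moreover have "0 < 1 / (1 + c)" using \<open>c > 0\<close> by simp
    \<comment> \<open>Division by 0 gives 0, which a quotient above a positive number
      excludes.\<close>
    ultimately have "?b \<noteq> 0" by (metis div_by_0 order_less_asym)
    then have "?b > 0" by linarith
    with quot have "?b < (1 + c) * ?a"
      using \<open>c > 0\<close> by (simp add: field_simps)
    moreover have "{i \<in> T. x \<in> ?N i} = {i \<in> S. x \<in> ?N i}" "{i \<in> T. x \<in> ?A i} = {i \<in> S. x \<in> ?A i}"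
      using x by (auto simp: T_def)
    ultimately show "real (card {i \<in> T. x \<in> ?N i}) < (1 + c) * real (card {i \<in> T. x \<in> ?A i})"
      by simp
  qed
  then obtain i where i: "i \<in> T" "real (card (?N i)) < (1 + c) * real (card (?A i))" by blast
  then have "i \<in> S" by (auto simp: T_def)
  have "finite (?A i)" "finite (halo (G n) (?A i))" "?A i \<inter> halo (G n) (?A i) = {}"
    using finite_subset[OF A[OF \<open>i \<in> S\<close>] fin] fin[of n] by (auto simp: halo_def M_def)
  then have "card (?N i) = card (?A i) + card (halo (G n) (?A i))"
    by (rule card_Un_disjoint)
  with i(2) \<open>i \<in> S\<close> show ?thesis by (intro bexI[of _ i]) (simp_all add: algebra_simps)
qed

theorem theorem7p8:
  fixes G :: "nat \<Rightarrow> ('a, 'b) pre_digraph"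
  assumes "graph_sequence G"
    and "expander_light G"
  shows "\<not> coarsely_amenable (SIGMA n:UNIV. verts (G n))
            (coarse_union_dist (\<lambda>n. verts (G n)) (\<lambda>n. graph_dist (G n)))"
proof
  let ?X = "SIGMA n:UNIV. verts (G n)"
  let ?d = "coarse_union_dist (\<lambda>n. verts (G n)) (\<lambda>n. graph_dist (G n))"
  let ?diam = "\<lambda>n. mdiameter (graph_dist (G n))"
  assume amenable: "coarsely_amenable ?X ?d"
  have graph: "pseudo_graph (G n)" "connected (G n)" for n
    using assms(1) by (auto simp: graph_sequence_def)
  obtain c where "c > 0" and c: "\<And>A. (\<And>n. A n \<subseteq> verts (G n)) \<Longrightarrow> (\<exists>R. \<forall>n. ?diam n (A n) \<le> R) \<Longrightarrow>
      (\<exists>\<^sub>\<infinity>n. real (card (halo (G n) (A n))) \<ge> c * real (card (A n)))"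
    using assms(2) unfolding expander_light_def by blast
  have "0 < c / (1 + c)" using \<open>c > 0\<close> by simp
  then obtain S :: "((nat \<times> 'a) \<times> nat) set" and U
    where cov: "amenability_cover ?X ?d 1 2 (c / (1 + c)) S U"
    using amenable unfolding coarsely_amenable_def
    by (metis one_less_numeral_iff semiring_norm(76) zero_less_one)
  obtain R where R: "\<And>i x y. i \<in> S \<Longrightarrow> x \<in> U i \<Longrightarrow> y \<in> U i \<Longrightarrow> ?d x y < R"
    using cov unfolding amenability_cover_def uniformly_bounded_def by blast
  \<comment> \<open>In the common bound, \<open>R\<close> serves the traces of cover elements and 2
    serves the components of small diameter.\<close>
  have "\<exists>A \<subseteq> verts (G n). ?diam n A \<le> max 2 R \<and> real (card (halo (G n) A)) < c * real (card A)" for n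
  proof (cases "?diam n (verts (G n)) \<ge> 2")
    case True
    obtain i where i: "i \<in> S"
      "real (card (halo (G n) (Pair n -` U i))) < c * real (card (Pair n -` U i))"
      using amenability_cover_small_halo[OF graph cov \<open>c > 0\<close> True] by blast
    have "Pair n -` U i \<subseteq> verts (G n)"
      using cov i(1) unfolding amenability_cover_def is_cover_def by blast
    moreover have "?diam n (Pair n -` U i) \<le> max 2 R"
    proof (rule mdiameter_least)
      \<comment> \<open>For an empty trace the right side of the strict inequality would be
        0.\<close>
      show "Pair n -` U i \<noteq> {}" using i(2) by auto
      fix x y assume "x \<in> Pair n -` U i" "y \<in> Pair n -` U i"
      then have "graph_dist (G n) x y < R"
        using R[OF i(1), of "(n, x)" "(n, y)"] by (simp add: coarse_union_dist_def)
      then show "graph_dist (G n) x y \<le> max 2 R" by simp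
    qed
    ultimately show ?thesis using i(2) by blast
  next
    \<comment> \<open>Here a 2-ball of the union may reach into another component, so the cover is
      not consulted; nonemptiness of the vertex set makes the inequality strict.\<close>
    case False
    interpret pseudo_graph "G n" by (rule graph)
    have "verts (G n) \<noteq> {}"
      using graph(2)[of n] by (auto simp: connected_def strongly_connected_def)
    moreover have "halo (G n) (verts (G n)) = {}" by (auto simp: halo_def)
    ultimately show ?thesis
      using False \<open>c > 0\<close> by (intro exI[of _ "verts (G n)"]) (auto simp: card_gt_0_iff)
  qed
  then obtain A where A: "\<And>n. A n \<subseteq> verts (G n)" "\<And>n. ?diam n (A n) \<le> max 2 R"
    "\<And>n. real (card (halo (G n) (A n))) < c * real (card (A n))"
    by metis
  have "\<exists>\<^sub>\<infinity>n. real (card (halo (G n) (A n))) \<ge> c * real (card (A n))"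
    using A(1,2) by (intro c) blast+
  then show False
    using A(3) by (simp add: not_le[symmetric])
qed

end
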